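(* Let $f:\mathbb{R}^{nd}\to\mathbb{R}$, $f(x)=\sum_{i=1}^n f_i(x_i)$, be convex and $L$-smooth with $L>0$, i.e. $f$ is differentiable and $\|\nabla f(x)-\nabla f(y)\|\le L\|x-y\|$ for all $x,y\in\mathbb{R}^{nd}$. Let $\mathcal{D}=\bigcap_{l\in\mathrm{clq}(G)}\{x\in\mathbb{R}^{nd}:x_{\mathcal{C}_l}\in\mathcal{D}_l\}$ be a non-empty closed convex set, and let $T$ be the clique-based projection onto $\mathcal{D}$. Let $t\in(0,1/L]$ and let $\{x(k)\}$ be generated by $$x(k+1)=T\bigl(\hat{x}(k)-t\nabla f(\hat{x}(k))\bigr),\qquad \hat{x}(k+1)=x(k+1)+\frac{\sigma_k-1}{\sigma_{k+1}}\,(x(k+1)-x(k)),\qquad k=0,1,2,\ldots,$$ where $\sigma_0=1$ and $\sigma_{k+1}=\bigl(1+\sqrt{1+4\sigma_k^2}\bigr)/2$. Then for any initial state $x(0)=\hat{x}(0)=x_0\in\mathbb{R}^{nd}$ and any $x_*\in\arg\min_{x\in\mathcal{D}}f(x)$, for all $k\in\mathbb{N}$, $$J(x(k))-J(x_* )\le\frac{2\|x_0-x_*\|^2}{tk^2},$$ where $J(x)=f(x)+V(x)/t$.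
   Context: $\mathbb{N}$ is the set of positive integers. $\|\cdot\|$ is the Euclidean norm, and for a symmetric positive definite $Q$, $\|v\|_Q=\sqrt{v^\top Qv}$. $G=(\mathcal{N},\mathcal{E})$ is an undirected graph with $\mathcal{N}=\{1,\ldots,n\}$. A clique is a subset of $\mathcal{N}$ inducing a complete subgraph; it is maximal if it is not contained in any other clique. $\mathrm{clq}(G)=\{1,\ldots,q\}$ indexes the maximal cliques $\mathcal{C}_1,\ldots,\mathcal{C}_q$ of $G$, and $\mathrm{clq}_i(G)=\{l\in\mathrm{clq}(G):i\in\mathcal{C}_l\}$. Vectors $x\in\mathbb{R}^{nd}$ are written $x=[x_1^\top,\ldots,x_n^\top]^\top$ with $x_i\in\mathbb{R}^d$; for $\mathcal{C}=\{j_1<\cdots<j_{|\mathcal{C}|}\}\subset\mathcal{N}$, $x_{\mathcal{C}}=[x_{j_1}^\top,\ldots,x_{j_{|\mathcal{C}|}}^\top]^\top$. For each $l\in\mathrm{clq}(G)$, $\mathcal{D}_l\subset\mathbb{R}^{|\mathcal{C}_l|d}$ is a non-empty closed convex set. Each $f_i$ is a real-valued function on $\mathbb{R}^d$. Let $\gamma=[1/|\mathrm{clq}_1(G)|,\ldots,1/|\mathrm{clq}_n(G)|]^\top\otimes\mathbf{1}_d\in\mathbb{R}^{nd}$, where $\mathbf{1}_d$ is the all-ones vector (so $\mathrm{diag}(\gamma_{\mathcal{C}_l})$ is the block-diagonal matrix with blocks $\frac{1}{|\mathrm{clq}_i(G)|}I_d$, $i\in\mathcal{C}_l$). Let $P_{\mathcal{D}_l}(x_{\mathcal{C}_l})=\arg\min_{z\in\mathcal{D}_l}\|z-x_{\mathcal{C}_l}\|_{\mathrm{diag}(\gamma_{\mathcal{C}_l})}$.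 The clique-based projection $T:\mathbb{R}^{nd}\to\mathbb{R}^{nd}$ onto $\mathcal{D}$ is $T(x)=[T_1^\top,\ldots,T_n^\top]^\top$ with $$T_i=\frac{1}{|\mathrm{clq}_i(G)|}\sum_{l\in\mathrm{clq}_i(G)}[P_{\mathcal{D}_l}(x_{\mathcal{C}_l})]_{m_{l,i}},$$ where $m_{l,i}$ is the position of $i$ in the increasing ordering of $\mathcal{C}_l$ and $[v]_j\in\mathbb{R}^d$ is the $j$th $d$-dimensional block of $v$. Finally $$V(x)=\frac12\sum_{l\in\mathrm{clq}(G)}\|x_{\mathcal{C}_l}-P_{\mathcal{D}_l}(x_{\mathcal{C}_l})\|^2_{\mathrm{diag}(\gamma_{\mathcal{C}_l})}.$$ *)

theory Defs
  imports "HOL-Analysis.Analysis" "HOL-Library.Ramsey"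
begin

text \<open>
  The finite type \<open>'n\<close> is the node set, and \<open>real ^ 'd ^ 'n\<close> is the space of stacked
  vectors \<open>x\<close> with blocks \<open>x $ i\<close>; its norm is the Euclidean norm of the stacked vector.
  The space of vectors with one block for each node of \<open>C\<close> is represented by the subspace
  of vectors whose blocks outside \<open>C\<close> vanish. Blocks are thus addressed by the node itself
  rather than by its position in the increasing enumeration of \<open>C\<close>.
\<close>

definition clique_space :: "'n set \<Rightarrow> (real ^ 'd ^ 'n) set" where
  "clique_space C = {v. \<forall>i. i \<notin> C \<longrightarrow> v $ i = 0}"

definition subvec :: "'n set \<Rightarrow> real ^ 'd ^ 'n \<Rightarrow> real ^ 'd ^ 'n" where
  "subvec C x = (\<chi> i. if i \<in> C then x $ i else 0)"

definition undirected_graph :: "'n set set \<Rightarrow> bool" where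
  "undirected_graph E \<longleftrightarrow> (\<forall>e\<in>E. \<exists>i j. e = {i, j})"

definition maximal_clique :: "'n set set \<Rightarrow> 'n set \<Rightarrow> bool" where
  "maximal_clique E K \<longleftrightarrow> clique K E \<and> \<not> (\<exists>K'. clique K' E \<and> K \<subset> K')"

text \<open>In what follows \<open>C 1, \<dots>, C q\<close> enumerate the maximal cliques.\<close>

definition clq_at :: "nat \<Rightarrow> (nat \<Rightarrow> 'n set) \<Rightarrow> 'n \<Rightarrow> nat set" where
  "clq_at q C i = {l \<in> {1..q}. i \<in> C l}"

definition clq_weight :: "nat \<Rightarrow> (nat \<Rightarrow> 'n set) \<Rightarrow> real ^ 'd ^ 'n" where
  "clq_weight q C = (\<chi> i j. 1 / real (card (clq_at q C i)))"

definition diag_op :: "real ^ 'd ^ 'n \<Rightarrow> real ^ 'd ^ 'n \<Rightarrow> real ^ 'd ^ 'n" where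
  "diag_op w v = (\<chi> i j. w $ i $ j * v $ i $ j)"

definition qnorm :: "('a::real_inner \<Rightarrow> 'a) \<Rightarrow> 'a \<Rightarrow> real" where
  "qnorm Q v = sqrt (v \<bullet> Q v)"

text \<open>The weighted norm attached to the \<open>l\<close>-th clique; it is definite on
  \<open>clique_space (C l)\<close>, the only place where it is used.\<close>

definition clq_norm :: "nat \<Rightarrow> (nat \<Rightarrow> 'n set) \<Rightarrow> nat \<Rightarrow> real ^ 'd ^ 'n \<Rightarrow> real" where
  "clq_norm q C l v = qnorm (diag_op (subvec (C l) (clq_weight q C))) v"

definition proj_D ::
  "nat \<Rightarrow> (nat \<Rightarrow> 'n set) \<Rightarrow> (nat \<Rightarrow> (real ^ 'd ^ 'n) set) \<Rightarrow> nat \<Rightarrow> real ^ 'd ^ 'n \<Rightarrow> real ^ 'd ^ 'n"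
  where "proj_D q C D l y = (ARG_MIN (\<lambda>z. clq_norm q C l (z - y)) z. z \<in> D l)"

definition clique_proj ::
  "nat \<Rightarrow> (nat \<Rightarrow> 'n set) \<Rightarrow> (nat \<Rightarrow> (real ^ 'd ^ 'n) set) \<Rightarrow> real ^ 'd ^ 'n \<Rightarrow> real ^ 'd ^ 'n"
  where "clique_proj q C D x =
    (\<chi> i. (1 / real (card (clq_at q C i))) *\<^sub>R
          (\<Sum>l\<in>clq_at q C i. proj_D q C D l (subvec (C l) x) $ i))"

definition clique_V ::
  "nat \<Rightarrow> (nat \<Rightarrow> 'n set) \<Rightarrow> (nat \<Rightarrow> (real ^ 'd ^ 'n) set) \<Rightarrow> real ^ 'd ^ 'n \<Rightarrow> real"
  where "clique_V q C D x =
    1 / 2 * (\<Sum>l = 1..q. (clq_norm q C l (subvec (C l) x - proj_D q C D l (subvec (C l) x)))\<^sup>2)"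

definition feasible_set ::
  "nat \<Rightarrow> (nat \<Rightarrow> 'n set) \<Rightarrow> (nat \<Rightarrow> (real ^ 'd ^ 'n) set) \<Rightarrow> (real ^ 'd ^ 'n) set"
  where "feasible_set q C D = (\<Inter>l\<in>{1..q}. {x. subvec (C l) x \<in> D l})"

definition grad :: "('a::real_inner \<Rightarrow> real) \<Rightarrow> 'a \<Rightarrow> 'a" where
  "grad f x = (THE g. GDERIV f x :> g)"

definition L_smooth :: "real \<Rightarrow> ('a::real_inner \<Rightarrow> real) \<Rightarrow> bool" where
  "L_smooth L f \<longleftrightarrow> (\<forall>x. f differentiable (at x)) \<and>
     (\<forall>x y. norm (grad f x - grad f y) \<le> L * norm (x - y))"

end

theory Submission
  imports Defs
begin

text \<open>
  In general \<open>T y\<close> is not the projection of \<open>y\<close> onto the feasible set, and \<open>J\<close> need not satisfy the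
  one-step estimate of accelerated proximal gradient methods, because the update is not a proximal
  step for \<open>V / t\<close>. It is, however, a proximal step for another function \<open>W / t\<close>, and the
  trajectory is the accelerated proximal gradient method for \<open>f + W / t\<close>.

  Each node is averaged with exactly the weights that define the clique norms, so restriction to
  the cliques is an isometry into the weighted product space and averaging is its adjoint. Hence
  \<open>x - T x\<close> is the gradient of \<open>V\<close>. Since projections onto convex sets are firmly nonexpansive, this
  gradient is cocoercive (\<open>V_cocoercive\<close>):
  \<open>V w \<ge> V y + (y - T y) \<bullet> (w - y) + (norm ((w - T w) - (y - T y)))\<^sup>2 / 2\<close>.
  A map \<open>T\<close> of the form identity minus such a gradient is the proximal map of a convex
  function \<open>W\<close>, with \<open>W (T w) = V w - (norm (w - T w))\<^sup>2 / 2\<close>; this value is called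
  \<open>prox_penalty w\<close>, and cocoercivity is precisely the subgradient inequality for \<open>W\<close> between
  points of the range of \<open>T\<close> (\<open>prox_penalty_subgradient\<close>). All points at which the analysis
  needs \<open>W\<close> lie in this range: the iterates from index one on, and the minimiser, which is a fixed
  point of \<open>T\<close>.

  Combined with the descent lemma and convexity of \<open>f\<close>, this yields the classical rate
  (\<open>accelerated_rate\<close>) for \<open>f + W / t\<close>. The rate passes to \<open>J\<close> because \<open>V (T w) \<le> W (T w)\<close>
  (\<open>V_clique_proj_le\<close>), while \<open>V\<close> and \<open>W\<close> both vanish at the minimiser.
\<close>

section \<open>Gradients of convex and smooth functions\<close>

lemma GDERIV_grad:
  fixes f :: "'a::euclidean_space \<Rightarrow> real"
  assumes "f differentiable (at x)"
  shows "GDERIV f x :> grad f x"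
proof -
  obtain f' where f': "(f has_derivative f') (at x)"
    using assms unfolding differentiable_def by blast
  then have lin: "linear f'"
    by (simp add: has_derivative_linear)
  have "f' h = h \<bullet> adjoint f' 1" for h
    using adjoint_works[OF lin, of h 1] by simp
  then have "f' = (\<lambda>h. h \<bullet> adjoint f' 1)"
    by blast
  with f' have ex: "GDERIV f x :> adjoint f' 1"
    unfolding gderiv_def by metis
  have uniq: "g = g'" if "GDERIV f x :> g" "GDERIV f x :> g'" for g g'
  proof -
    have "(\<lambda>h. h \<bullet> g) = (\<lambda>h. h \<bullet> g')"
      using that has_derivative_unique unfolding gderiv_def by blast
    then have "h \<bullet> (g - g') = 0" for h
      by (simp add: inner_diff_right) metis
    then show ?thesis
      using inner_eq_zero_iff[of "g - g'"] by simp
  qed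
  show ?thesis
    unfolding grad_def using ex uniq by (metis (no_types, lifting) theI)
qed

lemma DERIV_along_line:
  fixes f :: "'a::euclidean_space \<Rightarrow> real"
  assumes "\<And>z. f differentiable (at z)"
  shows "((\<lambda>s. f (x + s *\<^sub>R v)) has_real_derivative grad f (x + s *\<^sub>R v) \<bullet> v) (at s)"
proof -
  have *: "((\<lambda>s. x + s *\<^sub>R v) has_derivative (\<lambda>h. h *\<^sub>R v)) (at s)"
    by (auto intro!: derivative_eq_intros)
  have "(f has_derivative (\<lambda>h. h \<bullet> grad f (x + s *\<^sub>R v))) (at (x + s *\<^sub>R v))"
    using GDERIV_grad[OF assms] unfolding gderiv_def .
  from has_derivative_compose[OF * this]
  show ?thesis
    unfolding has_field_derivative_def
    by (simp add: inner_commute mult_commute_abs)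
qed

lemma convex_on_grad_below:
  fixes f :: "'a::euclidean_space \<Rightarrow> real"
  assumes conv: "convex_on UNIV f" and diff: "\<And>z. f differentiable (at z)"
  shows "f x + grad f x \<bullet> (y - x) \<le> f y"
proof -
  let ?h = "\<lambda>s. f (x + s *\<^sub>R (y - x))"
  have "convex_on UNIV ?h"
  proof (rule convex_onI)
    fix u a b :: real
    assume "0 < u" "u < 1"
    have "x + ((1 - u) *\<^sub>R a + u *\<^sub>R b) *\<^sub>R (y - x)
        = (1 - u) *\<^sub>R (x + a *\<^sub>R (y - x)) + u *\<^sub>R (x + b *\<^sub>R (y - x))"
      by (simp add: algebra_simps)
    then show "?h ((1 - u) *\<^sub>R a + u *\<^sub>R b) \<le> (1 - u) * ?h a + u * ?h b"
      using convex_onD[OF conv, of u] \<open>0 < u\<close> \<open>u < 1\<close> by simp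
  qed simp
  moreover have "(?h has_real_derivative grad f x \<bullet> (y - x)) (at 0)"
    using DERIV_along_line[OF diff, of x "y - x" 0] by simp
  ultimately have "?h 1 - ?h 0 \<ge> (grad f x \<bullet> (y - x)) * (1 - 0)"
    by (intro convex_on_imp_above_tangent[where A = UNIV]) auto
  then show ?thesis by simp
qed

text \<open>On the segment from \<open>x\<close> to \<open>y\<close>, the difference between \<open>f\<close> and the claimed quadratic
  upper bound has derivative at most zero, by Cauchy--Schwarz and the Lipschitz bound.\<close>

lemma L_smooth_descent:
  fixes f :: "'a::euclidean_space \<Rightarrow> real"
  assumes "L_smooth L f"
  shows "f y \<le> f x + grad f x \<bullet> (y - x) + L / 2 * (norm (y - x))\<^sup>2"
proof -
  have diff: "\<And>z. f differentiable (at z)"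
    and lip: "\<And>a b. norm (grad f a - grad f b) \<le> L * norm (a - b)"
    using assms unfolding L_smooth_def by auto
  define v where "v = y - x"
  define h where "h s = f (x + s *\<^sub>R v) - s * (grad f x \<bullet> v) - L / 2 * s\<^sup>2 * (norm v)\<^sup>2" for s
  have der: "(h has_real_derivative
      (grad f (x + s *\<^sub>R v) \<bullet> v - grad f x \<bullet> v - L * s * (norm v)\<^sup>2)) (at s)" for s
    unfolding h_def
    by (rule derivative_eq_intros DERIV_along_line[OF diff] refl | simp)+
  have "grad f (x + s *\<^sub>R v) \<bullet> v - grad f x \<bullet> v - L * s * (norm v)\<^sup>2 \<le> 0" if "s \<ge> 0" for s
  proof -
    have "(grad f (x + s *\<^sub>R v) - grad f x) \<bullet> v
        \<le> norm (grad f (x + s *\<^sub>R v) - grad f x) * norm v"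
      by (rule norm_cauchy_schwarz)
    also have "\<dots> \<le> L * norm (s *\<^sub>R v) * norm v"
      using lip[of "x + s *\<^sub>R v" x] by (intro mult_right_mono) auto
    also have "\<dots> = L * s * (norm v)\<^sup>2"
      using that by (simp add: power2_eq_square)
    finally show ?thesis by (simp add: inner_diff_left)
  qed
  then have "h 1 \<le> h 0"
    using der by (intro DERIV_nonpos_imp_nonincreasing[of 0 1 h]) (simp, blast)
  then show ?thesis
    by (simp add: h_def v_def)
qed

section \<open>Averaging over the cliques\<close>

text \<open>The square root of the weights, so that the clique norm of a vector supported on its clique
  becomes a Euclidean norm.\<close>

definition clq_scale :: "nat \<Rightarrow> (nat \<Rightarrow> 'n set) \<Rightarrow> real ^ 'd ^ 'n \<Rightarrow> real ^ 'd ^ 'n" where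
  "clq_scale q C v = (\<chi> i. (1 / sqrt (real (card (clq_at q C i)))) *\<^sub>R v $ i)"

definition clq_avg :: "nat \<Rightarrow> (nat \<Rightarrow> 'n set) \<Rightarrow> (nat \<Rightarrow> real ^ 'd ^ 'n) \<Rightarrow> real ^ 'd ^ 'n" where
  "clq_avg q C R = (\<chi> i. (1 / real (card (clq_at q C i))) *\<^sub>R (\<Sum>l\<in>clq_at q C i. R l $ i))"

lemma inner_clq_scale:
  "clq_scale q C u \<bullet> clq_scale q C v
    = (\<Sum>i\<in>UNIV. (u $ i \<bullet> v $ i) / real (card (clq_at q C i)))"
  unfolding inner_vec_def[of "clq_scale q C u"]
  by (intro sum.cong refl) (simp add: clq_scale_def flip: real_sqrt_mult)

lemma linear_clq_scale: "linear (clq_scale q C)"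
  by (rule linearI) (auto simp: clq_scale_def vec_eq_iff algebra_simps)

lemma clq_scale_diff: "clq_scale q C (u - v) = clq_scale q C u - clq_scale q C v"
  by (rule linear_diff[OF linear_clq_scale])

lemma clq_norm_eq_norm_scale:
  assumes "v \<in> clique_space (C l)"
  shows "clq_norm q C l v = norm (clq_scale q C v)"
proof -
  have "v \<bullet> diag_op (subvec (C l) (clq_weight q C)) v = clq_scale q C v \<bullet> clq_scale q C v"
    unfolding inner_clq_scale inner_vec_def[of v]
  proof (intro sum.cong refl)
    fix i
    show "v $ i \<bullet> diag_op (subvec (C l) (clq_weight q C)) v $ i
        = (v $ i \<bullet> v $ i) / real (card (clq_at q C i))"
    proof (cases "i \<in> C l")
      case True
      then show ?thesis
        unfolding inner_vec_def[of "v $ i"] sum_divide_distrib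
        by (intro sum.cong refl) (simp add: diag_op_def subvec_def clq_weight_def)
    next
      case False
      then have "v $ i = 0"
        using assms by (simp add: clique_space_def)
      then show ?thesis by simp
    qed
  qed
  then show ?thesis
    by (simp add: clq_norm_def qnorm_def norm_eq_sqrt_inner)
qed

lemma subvec_diff: "subvec K (u - v) = subvec K u - subvec K v"
  by (auto simp: subvec_def vec_eq_iff)

lemma subvec_in_clique_space: "subvec K x \<in> clique_space K"
  by (simp add: subvec_def clique_space_def)

lemma clique_space_diff: "u \<in> clique_space K \<Longrightarrow> v \<in> clique_space K \<Longrightarrow> u - v \<in> clique_space K"
  by (simp add: clique_space_def)

text \<open>Averaging is the adjoint of restriction to the cliques: the weights \<open>1 / |clq_i|\<close> of the
  clique norms are exactly the averaging weights of node \<open>i\<close>.\<close>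

lemma sum_inner_clq_scale_subvec:
  "(\<Sum>l = 1..q. clq_scale q C (R l) \<bullet> clq_scale q C (subvec (C l) v)) = clq_avg q C R \<bullet> v"
proof -
  have "(\<Sum>l = 1..q. clq_scale q C (R l) \<bullet> clq_scale q C (subvec (C l) v))
      = (\<Sum>i\<in>UNIV. \<Sum>l = 1..q. (R l $ i \<bullet> subvec (C l) v $ i) / real (card (clq_at q C i)))"
    unfolding inner_clq_scale by (rule sum.swap)
  also have "\<dots> = (\<Sum>i\<in>UNIV. clq_avg q C R $ i \<bullet> v $ i)"
  proof (intro sum.cong refl)
    fix i
    have "(\<Sum>l = 1..q. (R l $ i \<bullet> subvec (C l) v $ i) / real (card (clq_at q C i)))
        = (\<Sum>l = 1..q. if i \<in> C l then (R l $ i \<bullet> v $ i) / real (card (clq_at q C i)) else 0)"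
      by (intro sum.cong refl) (simp add: subvec_def)
    also have "\<dots> = (\<Sum>l\<in>clq_at q C i. (R l $ i \<bullet> v $ i) / real (card (clq_at q C i)))"
      unfolding clq_at_def by (rule sum.inter_filter[symmetric]) simp
    also have "\<dots> = clq_avg q C R $ i \<bullet> v $ i"
      by (simp add: clq_avg_def inner_sum_left sum_divide_distrib)
    finally show "(\<Sum>l = 1..q. (R l $ i \<bullet> subvec (C l) v $ i) / real (card (clq_at q C i)))
        = clq_avg q C R $ i \<bullet> v $ i" .
  qed
  finally show ?thesis by (simp add: inner_vec_def)
qed

text \<open>A singleton is a clique, and by finiteness it extends to a maximal one. This makes the
  averaging weights meaningful.\<close>

lemma clq_at_nonempty:
  fixes E :: "'n::finite set set"
  assumes "bij_betw C {1..q} {K. maximal_clique E K}"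
  shows "clq_at q C i \<noteq> {}"
proof -
  have "finite {K. clique K E \<and> i \<in> K}"
    by simp
  moreover have "{i} \<in> {K. clique K E \<and> i \<in> K}"
    by (simp add: clique_def)
  ultimately obtain K where K: "K \<in> {K. clique K E \<and> i \<in> K}"
    and max: "\<And>K'. K' \<in> {K. clique K E \<and> i \<in> K} \<Longrightarrow> K \<subseteq> K' \<Longrightarrow> K = K'"
    using finite_has_maximal2[of "{K. clique K E \<and> i \<in> K}" "{i}"] by metis
  have "maximal_clique E K"
    unfolding maximal_clique_def using K max by blast
  then have "K \<in> C ` {1..q}"
    using bij_betw_imp_surj_on[OF assms] by simp
  then obtain l where "l \<in> {1..q}" "K = C l"
    by (rule imageE)
  then show ?thesis
    using K by (auto simp: clq_at_def)
qed

section \<open>The clique-based projection\<close>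

locale clique_constraints =
  fixes q :: nat and C :: "nat \<Rightarrow> 'n::finite set" and D :: "nat \<Rightarrow> (real ^ 'd ^ 'n) set"
  assumes cover: "clq_at q C i \<noteq> {}"
    and D_sub: "l \<in> {1..q} \<Longrightarrow> D l \<subseteq> clique_space (C l)"
    and D_ne: "l \<in> {1..q} \<Longrightarrow> D l \<noteq> {}"
    and D_closed: "l \<in> {1..q} \<Longrightarrow> closed (D l)"
    and D_convex: "l \<in> {1..q} \<Longrightarrow> convex (D l)"
begin

abbreviation s :: "real ^ 'd ^ 'n \<Rightarrow> real ^ 'd ^ 'n" where
  "s \<equiv> clq_scale q C"

abbreviation "T \<equiv> clique_proj q C D"
abbreviation "V \<equiv> clique_V q C D"

abbreviation proj :: "nat \<Rightarrow> real ^ 'd ^ 'n \<Rightarrow> real ^ 'd ^ 'n" where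
  "proj l x \<equiv> proj_D q C D l (subvec (C l) x)"

abbreviation resid :: "nat \<Rightarrow> real ^ 'd ^ 'n \<Rightarrow> real ^ 'd ^ 'n" where
  "resid l x \<equiv> subvec (C l) x - proj l x"

lemma card_clq_at_pos: "card (clq_at q C i) > 0"
  using cover[of i] by (simp add: card_gt_0_iff clq_at_def)

lemma inj_clq_scale: "inj s"
proof (rule injI)
  fix u v :: "real ^ 'd ^ 'n"
  assume "s u = s v"
  then have "\<forall>i. s u $ i = s v $ i" by simp
  then have "u $ i = v $ i" for i
    using card_clq_at_pos[of i] by (auto simp: clq_scale_def dest: spec[of _ i])
  then show "u = v" by (simp add: vec_eq_iff)
qed

lemma clq_avg_subvec: "clq_avg q C (\<lambda>l. subvec (C l) v) = v"
proof -
  have "(\<Sum>l\<in>clq_at q C i. subvec (C l) v $ i) = real (card (clq_at q C i)) *\<^sub>R v $ i" for i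
  proof -
    have "(\<Sum>l\<in>clq_at q C i. subvec (C l) v $ i) = (\<Sum>l\<in>clq_at q C i. v $ i)"
      by (intro sum.cong refl) (simp add: subvec_def clq_at_def)
    then show ?thesis by (simp only: sum_constant_scaleR)
  qed
  then show ?thesis
    using card_clq_at_pos by (simp add: clq_avg_def vec_eq_iff)
qed

text \<open>Expanding the square, with averaging as the adjoint of restriction for the mixed term and
  restriction as an isometry for the last one. As a function of \<open>v\<close> it is minimal at the
  average of the \<open>R l\<close>.\<close>

lemma sum_norm_clq_scale_diff_subvec:
  "(\<Sum>l = 1..q. (norm (s (R l - subvec (C l) v)))\<^sup>2)
    = (\<Sum>l = 1..q. (norm (s (R l)))\<^sup>2) - 2 * (clq_avg q C R \<bullet> v) + (norm v)\<^sup>2"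
proof -
  have "(norm (s (R l - subvec (C l) v)))\<^sup>2 = (norm (s (R l)))\<^sup>2
      - 2 * (s (R l) \<bullet> s (subvec (C l) v)) + s (subvec (C l) v) \<bullet> s (subvec (C l) v)" for l
    unfolding clq_scale_diff power2_norm_eq_inner
    by (simp add: inner_diff_left inner_diff_right inner_commute)
  then have "(\<Sum>l = 1..q. (norm (s (R l - subvec (C l) v)))\<^sup>2)
      = (\<Sum>l = 1..q. (norm (s (R l)))\<^sup>2) - 2 * (clq_avg q C R \<bullet> v)
        + clq_avg q C (\<lambda>l. subvec (C l) v) \<bullet> v"
    by (simp only: sum.distrib sum_subtractf sum_inner_clq_scale_subvec flip: sum_distrib_left)
  then show ?thesis
    by (simp add: clq_avg_subvec power2_norm_eq_inner)
qed

lemma norm_clq_avg_le: "(norm (clq_avg q C R))\<^sup>2 \<le> (\<Sum>l = 1..q. (norm (s (R l)))\<^sup>2)"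
proof -
  have "0 \<le> (\<Sum>l = 1..q. (norm (s (R l - subvec (C l) (clq_avg q C R))))\<^sup>2)"
    by (simp add: sum_nonneg)
  then show ?thesis
    unfolding sum_norm_clq_scale_diff_subvec by (simp add: power2_norm_eq_inner)
qed

text \<open>The scaling \<open>s\<close> turns the weighted projection into a Euclidean closest point of the closed
  convex set \<open>s ` D l\<close>; this gives existence and the variational inequality below.\<close>

lemma
  assumes l: "l \<in> {1..q}"
  shows proj_in: "proj l x \<in> D l"
    and proj_le: "z \<in> D l \<Longrightarrow> norm (s (resid l x)) \<le> norm (s (subvec (C l) x - z))"
proof -
  let ?y = "subvec (C l) x"
  have norm_eq: "clq_norm q C l (z - ?y) = dist (s ?y) (s z)" if "z \<in> D l" for z
  proof -
    have "z - ?y \<in> clique_space (C l)"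
      using D_sub[OF l] that by (intro clique_space_diff subvec_in_clique_space) auto
    then show ?thesis
      by (simp add: clq_norm_eq_norm_scale clq_scale_diff dist_norm norm_minus_commute)
  qed
  have "closed (s ` D l)"
    using D_closed[OF l] linear_clq_scale inj_clq_scale by (rule closed_injective_linear_image)
  moreover have "s ` D l \<noteq> {}"
    using D_ne[OF l] by simp
  ultimately obtain a where a: "a \<in> s ` D l" "\<And>b. b \<in> s ` D l \<Longrightarrow> dist (s ?y) a \<le> dist (s ?y) b"
    using distance_attains_inf by metis
  obtain p where p: "a = s p" "p \<in> D l"
    using a(1) by (rule imageE)
  have "dist (s ?y) (s p) \<le> dist (s ?y) (s w)" if "w \<in> D l" for w
    using a(2)[of "s w"] that p by simp
  with p have "is_arg_min (\<lambda>z. clq_norm q C l (z - ?y)) (\<lambda>z. z \<in> D l) p"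
    by (auto simp: is_arg_min_linorder norm_eq)
  then have min: "is_arg_min (\<lambda>z. clq_norm q C l (z - ?y)) (\<lambda>z. z \<in> D l) (proj l x)"
    unfolding proj_D_def arg_min_def by (rule someI)
  then show mem: "proj l x \<in> D l"
    by (simp add: is_arg_min_def)
  assume "z \<in> D l"
  then show "norm (s (resid l x)) \<le> norm (s (?y - z))"
    using min mem
    by (auto simp: is_arg_min_linorder norm_eq clq_scale_diff dist_norm)
qed

lemma proj_variational:
  assumes l: "l \<in> {1..q}" and z: "z \<in> D l"
  shows "s (resid l x) \<bullet> s (z - proj l x) \<le> 0"
  unfolding clq_scale_diff
proof (rule any_closest_point_dot)
  show "convex (s ` D l)"
    by (rule convex_linear_image[OF linear_clq_scale D_convex[OF l]])
  show "closed (s ` D l)"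
    using D_closed[OF l] linear_clq_scale inj_clq_scale by (rule closed_injective_linear_image)
  show "s (proj l x) \<in> s ` D l" "s z \<in> s ` D l"
    using proj_in[OF l] z by auto
  show "\<forall>w\<in>s ` D l. dist (s (subvec (C l) x)) (s (proj l x)) \<le> dist (s (subvec (C l) x)) w"
    using proj_le[OF l] by (auto simp: clq_scale_diff dist_norm)
qed

lemma V_eq: "V x = 1 / 2 * (\<Sum>l = 1..q. (norm (s (resid l x)))\<^sup>2)"
proof -
  have "clq_norm q C l (resid l x) = norm (s (resid l x))" if "l \<in> {1..q}" for l
    using D_sub[OF that] proj_in[OF that]
    by (intro clq_norm_eq_norm_scale clique_space_diff subvec_in_clique_space) blast
  then show ?thesis
    unfolding clique_V_def by (auto intro!: sum.cong)
qed

lemma clq_avg_resid: "clq_avg q C (\<lambda>l. resid l x) = x - T x"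
proof -
  have "clq_avg q C (\<lambda>l. resid l x)
      = clq_avg q C (\<lambda>l. subvec (C l) x) - clq_avg q C (\<lambda>l. proj l x)"
    by (simp add: clq_avg_def vec_eq_iff sum_subtractf scaleR_diff_right)
  moreover have "clq_avg q C (\<lambda>l. proj l x) = T x"
    by (simp add: clq_avg_def clique_proj_def)
  ultimately show ?thesis
    by (simp add: clq_avg_subvec)
qed

text \<open>For a single projection the gap in this inequality is
  \<open>(y - P y) \<bullet> (P y - P w)\<close> in the scaled inner product, which is nonnegative by the variational inequality. Summing over
  the cliques turns the residuals into their averages \<open>y - T y\<close> and \<open>w - T w\<close>, and the quadratic
  term can only shrink. Thus \<open>x - T x\<close> behaves as the gradient of a convex \<open>1\<close>-smooth
  function \<open>V\<close>.\<close>

lemma V_cocoercive: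
  "V y + (y - T y) \<bullet> (w - y) + 1 / 2 * (norm ((w - T w) - (y - T y)))\<^sup>2 \<le> V w"
proof -
  let ?R = "\<lambda>l. resid l w - resid l y"
  have single: "1 / 2 * (norm (s (resid l y)))\<^sup>2 + s (resid l y) \<bullet> s (subvec (C l) (w - y))
      + 1 / 2 * (norm (s (?R l)))\<^sup>2 \<le> 1 / 2 * (norm (s (resid l w)))\<^sup>2"
    if l: "l \<in> {1..q}" for l
    using proj_variational[OF l proj_in[OF l], of y w]
    unfolding clq_scale_diff subvec_diff power2_norm_eq_inner
    by (simp add: inner_diff_left inner_diff_right inner_commute algebra_simps)
  have "V y + (y - T y) \<bullet> (w - y) + 1 / 2 * (\<Sum>l = 1..q. (norm (s (?R l)))\<^sup>2) \<le> V w"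
  proof -
    have "(\<Sum>l = 1..q. 1 / 2 * (norm (s (resid l y)))\<^sup>2 + s (resid l y) \<bullet> s (subvec (C l) (w - y))
        + 1 / 2 * (norm (s (?R l)))\<^sup>2) \<le> (\<Sum>l = 1..q. 1 / 2 * (norm (s (resid l w)))\<^sup>2)"
      by (intro sum_mono single)
    then show ?thesis
      unfolding V_eq sum.distrib sum_inner_clq_scale_subvec clq_avg_resid
      by (simp only: sum_distrib_left)
  qed
  moreover have "clq_avg q C ?R = (w - T w) - (y - T y)"
    unfolding clq_avg_resid[symmetric]
    by (simp add: clq_avg_def vec_eq_iff sum_subtractf scaleR_diff_right)
  ultimately show ?thesis
    using norm_clq_avg_le[of ?R] by simp
qed

text \<open>By \<open>V_cocoercive\<close>, \<open>T\<close> is the proximal map of the convex function \<open>W\<close> given by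
  \<open>W z = (SUP u. V u - (norm (z - u))\<^sup>2 / 2)\<close>. At \<open>z = T w\<close> the supremum is attained at
  \<open>u = w\<close>, so that the formula below is \<open>W (T w)\<close>. The function \<open>W\<close> may be infinite outside the
  range of \<open>T\<close>; parametrising by \<open>w\<close> keeps all values real.\<close>

definition prox_penalty :: "real ^ 'd ^ 'n \<Rightarrow> real" where
  "prox_penalty w = V w - 1 / 2 * (norm (w - T w))\<^sup>2"

text \<open>This says that \<open>y - T y\<close> is a subgradient of \<open>W\<close> at \<open>T y\<close>, tested at the point \<open>T w\<close>. It is
  \<open>V_cocoercive\<close> after expanding the squares.\<close>

lemma prox_penalty_subgradient:
  "prox_penalty y + (y - T y) \<bullet> (T w - T y) \<le> prox_penalty w"
  using V_cocoercive[of y w]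
  unfolding prox_penalty_def power2_norm_eq_inner
  by (simp add: inner_diff_left inner_diff_right inner_commute algebra_simps)

text \<open>Keeping the projections of \<open>w\<close> in place of those of \<open>T w\<close> can only increase the distances,
  and the sum of squared distances to the fixed points \<open>proj l w\<close> drops by \<open>(norm (w - T w))\<^sup>2\<close>
  when passing from \<open>w\<close> to their average \<open>T w\<close>.\<close>

lemma V_clique_proj_le: "V (T w) \<le> prox_penalty w"
proof -
  have "norm (s (resid l (T w))) \<le> norm (s (resid l w - subvec (C l) (w - T w)))"
    if "l \<in> {1..q}" for l
    using proj_le[OF that proj_in[OF that], of "T w" w] by (simp add: subvec_diff)
  then have "V (T w) \<le> 1 / 2 * (\<Sum>l = 1..q. (norm (s (resid l w - subvec (C l) (w - T w))))\<^sup>2)"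
    unfolding V_eq by (intro mult_left_mono sum_mono power_mono) auto
  also have "\<dots> = prox_penalty w"
    unfolding sum_norm_clq_scale_diff_subvec clq_avg_resid prox_penalty_def V_eq
    by (simp add: power2_norm_eq_inner)
  finally show ?thesis .
qed

lemma
  assumes "x \<in> feasible_set q C D"
  shows V_feasible: "V x = 0" and clique_proj_feasible: "T x = x"
proof -
  have zero: "norm (s (resid l x)) = 0" if "l \<in> {1..q}" for l
  proof -
    have "subvec (C l) x \<in> D l"
      using assms that by (auto simp: feasible_set_def)
    from proj_le[OF that this, of x] show ?thesis
      by (simp add: linear_0[OF linear_clq_scale])
  qed
  then show "V x = 0"
    unfolding V_eq by simp
  have "(norm (x - T x))\<^sup>2 \<le> 0"
    using norm_clq_avg_le[of "\<lambda>l. resid l x"] zero unfolding clq_avg_resid by simp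
  then show "T x = x" by simp
qed

end

section \<open>Acceleration\<close>

text \<open>The variance identity for the weights \<open>(c - 1) / c\<close> and \<open>1 / c\<close>, cleared of
  denominators. The last summand does not depend on \<open>h\<close> and cancels between two instances.\<close>

lemma weighted_square_combination:
  fixes a b h :: "'a::real_inner" and c :: real
  shows "c * ((c - 1) * (norm (a - h))\<^sup>2 + (norm (b - h))\<^sup>2)
    = (norm (c *\<^sub>R h - (c - 1) *\<^sub>R a - b))\<^sup>2 + (c - 1) * (norm (a - b))\<^sup>2"
  unfolding power2_norm_eq_inner
  by (simp add: inner_diff_left inner_diff_right inner_commute algebra_simps)

lemma
  fixes \<sigma> :: "nat \<Rightarrow> real"
  assumes "\<sigma> 0 = 1" and step: "\<And>m. \<sigma> (Suc m) = (1 + sqrt (1 + 4 * (\<sigma> m)\<^sup>2)) / 2"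
  shows stepsize_lower: "(real m + 2) / 2 \<le> \<sigma> m"
    and stepsize_square: "(\<sigma> (Suc m))\<^sup>2 - \<sigma> (Suc m) = (\<sigma> m)\<^sup>2"
proof -
  show "(real m + 2) / 2 \<le> \<sigma> m"
  proof (induction m)
    case 0
    then show ?case by (simp add: assms)
  next
    case (Suc m)
    have "2 * \<sigma> m \<le> sqrt (1 + 4 * (\<sigma> m)\<^sup>2)"
      by (rule real_le_rsqrt) (simp add: power2_eq_square)
    then show ?case
      using Suc unfolding step by simp
  qed
  have "(sqrt (1 + 4 * (\<sigma> m)\<^sup>2))\<^sup>2 = 1 + 4 * (\<sigma> m)\<^sup>2"
    by simp
  then show "(\<sigma> (Suc m))\<^sup>2 - \<sigma> (Suc m) = (\<sigma> m)\<^sup>2"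
    unfolding step by (simp add: power2_eq_square field_simps)
qed

text \<open>The sequence \<open>(\<sigma> m)\<^sup>2 * v (Suc m)\<close> plus a multiple of the squared distance between an
  extrapolated point \<open>u (Suc m) + xs\<close> and \<open>xs\<close> is nonincreasing, because the recursion of \<open>\<sigma>\<close> is chosen
  such that \<open>(\<sigma> (Suc m))\<^sup>2 - \<sigma> (Suc m) = (\<sigma> m)\<^sup>2\<close>; the growth of \<open>\<sigma>\<close> then gives the rate.
  The hypothesis \<open>near_prev\<close> is the one-step estimate with the previous iterate as comparison
  point. It enters with weight \<open>\<sigma> m - 1\<close>, which vanishes for \<open>m = 0\<close>; this matters because the
  starting point is arbitrary and the estimate can fail there.\<close>

lemma accelerated_rate:
  fixes x xhat :: "nat \<Rightarrow> 'a::real_inner" and v \<sigma> :: "nat \<Rightarrow> real"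
  assumes t: "t > 0"
    and sigma_0: "\<sigma> 0 = 1"
    and sigma_Suc: "\<And>m. \<sigma> (Suc m) = (1 + sqrt (1 + 4 * (\<sigma> m)\<^sup>2)) / 2"
    and init: "xhat 0 = x 0"
    and xhat_Suc: "\<And>m. xhat (Suc m) =
        x (Suc m) + ((\<sigma> m - 1) / \<sigma> (Suc m)) *\<^sub>R (x (Suc m) - x m)"
    and near_prev: "\<And>m. m \<ge> 1 \<Longrightarrow> v (Suc m) \<le> v m
        + 1 / (2 * t) * ((norm (x m - xhat m))\<^sup>2 - (norm (x m - x (Suc m)))\<^sup>2)"
    and near_opt: "\<And>m. v (Suc m) \<le>
        1 / (2 * t) * ((norm (xs - xhat m))\<^sup>2 - (norm (xs - x (Suc m)))\<^sup>2)"
    and k: "k \<ge> 1"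
  shows "v k \<le> 2 * (norm (x 0 - xs))\<^sup>2 / (t * (real k)\<^sup>2)"
proof -
  define u where "u m = \<sigma> m *\<^sub>R xhat m - (\<sigma> m - 1) *\<^sub>R x m - xs" for m
  have sigma_ge: "\<sigma> m \<ge> (real m + 2) / 2" for m
    using sigma_0 sigma_Suc by (rule stepsize_lower)
  have sigma_sq: "(\<sigma> (Suc m))\<^sup>2 - \<sigma> (Suc m) = (\<sigma> m)\<^sup>2" for m
    using sigma_0 sigma_Suc by (rule stepsize_square)
  have sigma_pos: "\<sigma> m \<ge> 1" for m
    using sigma_ge[of m] by simp
  have u_Suc: "u (Suc m) = \<sigma> m *\<^sub>R x (Suc m) - (\<sigma> m - 1) *\<^sub>R x m - xs" for m
  proof -
    have "\<sigma> (Suc m) *\<^sub>R xhat (Suc m)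
        = \<sigma> (Suc m) *\<^sub>R x (Suc m) + (\<sigma> m - 1) *\<^sub>R (x (Suc m) - x m)"
      using sigma_pos[of "Suc m"] by (simp add: xhat_Suc scaleR_add_right)
    then show ?thesis
      unfolding u_def by (simp add: algebra_simps)
  qed
  \<comment> \<open>Weigh the two estimates by \<open>\<sigma> m - 1\<close> and \<open>1\<close> and multiply by \<open>\<sigma> m\<close>; the squared
    distances then collapse to those of the extrapolated points.\<close>
  have step: "(\<sigma> m)\<^sup>2 * v (Suc m) + 1 / (2 * t) * (norm (u (Suc m)))\<^sup>2
      \<le> ((\<sigma> m)\<^sup>2 - \<sigma> m) * v m + 1 / (2 * t) * (norm (u m))\<^sup>2" for m
  proof -
    define c where "c = \<sigma> m"
    have c: "c \<ge> 1" by (simp add: c_def sigma_pos)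
    define p where "p = (norm (x m - xhat m))\<^sup>2 - (norm (x m - x (Suc m)))\<^sup>2"
    define r where "r = (norm (xs - xhat m))\<^sup>2 - (norm (xs - x (Suc m)))\<^sup>2"
    have "(c - 1) * v (Suc m) \<le> (c - 1) * (v m + 1 / (2 * t) * p)"
    proof (cases "m = 0")
      case True
      then show ?thesis by (simp add: c_def sigma_0)
    next
      case False
      then show ?thesis
        using near_prev[of m] c by (intro mult_left_mono) (auto simp: p_def)
    qed
    moreover have "v (Suc m) \<le> 1 / (2 * t) * r"
      using near_opt[of m] by (simp add: r_def)
    moreover have "(c - 1) * (v m + b * p) + b * r = (c - 1) * v m + b * ((c - 1) * p + r)" for b
      by (simp add: algebra_simps)
    moreover have "c * v (Suc m) = (c - 1) * v (Suc m) + v (Suc m)"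
      by (simp add: algebra_simps)
    ultimately have "c * v (Suc m) \<le> (c - 1) * v m + 1 / (2 * t) * ((c - 1) * p + r)"
      by (smt (verit))
    then have "c * (c * v (Suc m)) \<le> c * ((c - 1) * v m + 1 / (2 * t) * ((c - 1) * p + r))"
      using c by (intro mult_left_mono) auto
    moreover have "c * ((c - 1) * a + b * z) = (c\<^sup>2 - c) * a + b * (c * z)" for a b z :: real
      by (simp add: power2_eq_square algebra_simps)
    ultimately have "c\<^sup>2 * v (Suc m) \<le> (c\<^sup>2 - c) * v m + 1 / (2 * t) * (c * ((c - 1) * p + r))"
      by (simp only: power2_eq_square mult.assoc)
    also have "c * ((c - 1) * p + r) = (norm (u m))\<^sup>2 - (norm (u (Suc m)))\<^sup>2"
      using weighted_square_combination[of c "x m" "xhat m" xs]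
        weighted_square_combination[of c "x m" "x (Suc m)" xs]
      unfolding u_Suc unfolding u_def p_def r_def c_def by (simp add: algebra_simps)
    finally show ?thesis
      by (simp add: c_def right_diff_distrib diff_divide_distrib)
  qed
  have energy: "(\<sigma> m)\<^sup>2 * v (Suc m) + 1 / (2 * t) * (norm (u (Suc m)))\<^sup>2
      \<le> 1 / (2 * t) * (norm (x 0 - xs))\<^sup>2" for m
  proof (induction m)
    case 0
    then show ?case
      using step[of 0] by (simp add: u_def sigma_0 init)
  next
    case (Suc m)
    then show ?case
      using step[of "Suc m"] unfolding sigma_sq by linarith
  qed
  obtain m where m: "k = Suc m"
    using k by (cases k) auto
  have "0 \<le> 1 / (2 * t) * (norm (u (Suc m)))\<^sup>2"
    using t by simp
  then have "(\<sigma> m)\<^sup>2 * v k \<le> 1 / (2 * t) * (norm (x 0 - xs))\<^sup>2"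
    using energy[of m] unfolding m by linarith
  then have "v k \<le> 1 / (2 * t) * (norm (x 0 - xs))\<^sup>2 / (\<sigma> m)\<^sup>2"
    using sigma_pos[of m] by (subst pos_le_divide_eq) (simp, simp only: mult.commute)
  also have "\<dots> \<le> 1 / (2 * t) * (norm (x 0 - xs))\<^sup>2 / (real k / 2)\<^sup>2"
    using sigma_ge[of m] t k m
    by (intro divide_left_mono power_mono mult_pos_pos zero_less_power) auto
  also have "\<dots> = 2 * (norm (x 0 - xs))\<^sup>2 / (t * (real k)\<^sup>2)"
    by (simp add: power2_eq_square)
  finally show ?thesis .
qed

theorem theorem8:
  fixes E :: "'n::finite set set"
    and q :: nat
    and C :: "nat \<Rightarrow> 'n set"
    and D :: "nat \<Rightarrow> (real ^ 'd ^ 'n) set"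
    and fi :: "'n \<Rightarrow> real ^ 'd \<Rightarrow> real"
    and f J :: "real ^ 'd ^ 'n \<Rightarrow> real"
    and L t :: real
    and \<sigma> :: "nat \<Rightarrow> real"
    and x xhat :: "nat \<Rightarrow> real ^ 'd ^ 'n"
    and x0 xs :: "real ^ 'd ^ 'n"
    and k :: nat
  assumes graph: "undirected_graph E"
    and cliques: "bij_betw C {1..q} {K. maximal_clique E K}"
    and D_sub: "\<And>l. l \<in> {1..q} \<Longrightarrow> D l \<subseteq> clique_space (C l)"
    and D_ne: "\<And>l. l \<in> {1..q} \<Longrightarrow> D l \<noteq> {}"
    and D_closed: "\<And>l. l \<in> {1..q} \<Longrightarrow> closed (D l)"
    and D_convex: "\<And>l. l \<in> {1..q} \<Longrightarrow> convex (D l)"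
    and f_eq: "\<And>y. f y = (\<Sum>i\<in>UNIV. fi i (y $ i))"
    and f_convex: "convex_on UNIV f"
    and L_pos: "L > 0"
    and f_smooth: "L_smooth L f"
    and feas_ne: "feasible_set q C D \<noteq> {}"
    and feas_closed: "closed (feasible_set q C D)"
    and feas_convex: "convex (feasible_set q C D)"
    and t_range: "t \<in> {0<..1 / L}"
    and sigma_0: "\<sigma> 0 = 1"
    and sigma_Suc: "\<And>m. \<sigma> (Suc m) = (1 + sqrt (1 + 4 * (\<sigma> m)\<^sup>2)) / 2"
    and x_0: "x 0 = x0"
    and xhat_0: "xhat 0 = x0"
    and x_Suc: "\<And>m. x (Suc m) = clique_proj q C D (xhat m - t *\<^sub>R grad f (xhat m))"
    and xhat_Suc: "\<And>m. xhat (Suc m) =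
        x (Suc m) + ((\<sigma> m - 1) / \<sigma> (Suc m)) *\<^sub>R (x (Suc m) - x m)"
    and xs_min: "is_arg_min f (\<lambda>y. y \<in> feasible_set q C D) xs"
    and J_eq: "\<And>y. J y = f y + clique_V q C D y / t"
    and k_pos: "k \<ge> 1"
  shows "J (x k) - J xs \<le> 2 * (norm (x0 - xs))\<^sup>2 / (t * (real k)\<^sup>2)"
proof -
  interpret clique_constraints q C D
    using clq_at_nonempty[OF cliques] D_sub D_ne D_closed D_convex by unfold_locales auto
  have t: "t > 0" and tL: "L \<le> 1 / t"
    using t_range L_pos by (auto simp: field_simps)
  have diff: "\<And>z. f differentiable (at z)"
    using f_smooth by (simp add: L_smooth_def)
  define y where "y m = xhat m - t *\<^sub>R grad f (xhat m)" for m
  have x_T: "x (Suc m) = T (y m)" for m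
    by (simp add: x_Suc y_def)
  have step: "f (x (Suc m)) + prox_penalty (y m) / t \<le> f (T w) + prox_penalty w / t
      + 1 / (2 * t) * ((norm (T w - xhat m))\<^sup>2 - (norm (T w - x (Suc m)))\<^sup>2)" for m w
  proof -
    let ?g = "grad f (xhat m)"
    let ?h = "xhat m" and ?p = "x (Suc m)" and ?z = "T w"
    have "f ?p \<le> f ?h + ?g \<bullet> (?p - ?h) + L / 2 * (norm (?p - ?h))\<^sup>2"
      by (rule L_smooth_descent[OF f_smooth])
    also have "\<dots> \<le> f ?h + ?g \<bullet> (?p - ?h) + (1 / t) / 2 * (norm (?p - ?h))\<^sup>2"
      using tL by (intro add_left_mono mult_right_mono divide_right_mono) auto
    finally have up: "f ?p \<le> f ?h + ?g \<bullet> (?p - ?h) + (1 / t) / 2 * (norm (?p - ?h))\<^sup>2" .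
    have low: "f ?h + ?g \<bullet> (?z - ?h) \<le> f ?z"
      by (rule convex_on_grad_below[OF f_convex diff])
    have "prox_penalty (y m) + (?h - t *\<^sub>R ?g - ?p) \<bullet> (?z - ?p) \<le> prox_penalty w"
      using prox_penalty_subgradient[of "y m" w] by (simp add: x_T y_def)
    then have "(prox_penalty (y m) + (?h - t *\<^sub>R ?g - ?p) \<bullet> (?z - ?p)) / t \<le> prox_penalty w / t"
      using t by (intro divide_right_mono) auto
    moreover have "(prox_penalty (y m) + (?h - t *\<^sub>R ?g - ?p) \<bullet> (?z - ?p)) / t
        = prox_penalty (y m) / t + (?h - ?p) \<bullet> (?z - ?p) / t - ?g \<bullet> (?z - ?p)"
      using t by (simp add: inner_diff_left add_divide_distrib diff_divide_distrib)
    moreover have "?g \<bullet> (?p - ?h) = ?g \<bullet> (?z - ?h) - ?g \<bullet> (?z - ?p)"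
      by (simp add: inner_diff_right)
    moreover have "1 / (2 * t) * ((norm (?z - ?h))\<^sup>2 - (norm (?z - ?p))\<^sup>2)
        = (1 / t) / 2 * (norm (?p - ?h))\<^sup>2 - (?h - ?p) \<bullet> (?z - ?p) / t"
    proof -
      have "(norm (?z - ?h))\<^sup>2 - (norm (?z - ?p))\<^sup>2
          = (norm (?p - ?h))\<^sup>2 - 2 * ((?h - ?p) \<bullet> (?z - ?p))"
        unfolding power2_norm_eq_inner
        by (simp add: inner_diff_left inner_diff_right inner_commute algebra_simps)
      then show ?thesis
        using t by (simp add: field_simps)
    qed
    ultimately show ?thesis
      using up low by linarith
  qed
  have feas: "xs \<in> feasible_set q C D"
    using xs_min by (simp add: is_arg_min_def)
  have T_xs: "T xs = xs" and V_xs: "V xs = 0"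
    using clique_proj_feasible[OF feas] V_feasible[OF feas] by auto
  then have penalty_xs: "prox_penalty xs = 0"
    by (simp add: prox_penalty_def)
  \<comment> \<open>The accelerated scheme controls \<open>f\<close> plus the proximal penalty at \<open>x m = T (y (m - 1))\<close>. At
    \<open>m = 0\<close> the truncated index gives a value unrelated to \<open>x 0\<close>, which enters with weight zero.\<close>
  define v where "v m = f (x m) + prox_penalty (y (m - 1)) / t - f xs" for m
  have "v k \<le> 2 * (norm (x 0 - xs))\<^sup>2 / (t * (real k)\<^sup>2)"
  proof (rule accelerated_rate[where xhat = xhat and \<sigma> = \<sigma>, OF t sigma_0 sigma_Suc _ xhat_Suc _ _ k_pos])
    show "xhat 0 = x 0"
      by (simp add: x_0 xhat_0)
    show "v (Suc m) \<le> v m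
        + 1 / (2 * t) * ((norm (x m - xhat m))\<^sup>2 - (norm (x m - x (Suc m)))\<^sup>2)" if "m \<ge> 1" for m
    proof -
      have "x m = T (y (m - 1))"
        using x_T[of "m - 1"] that by simp
      then show ?thesis
        using step[of m "y (m - 1)"] by (simp add: v_def)
    qed
    show "v (Suc m) \<le> 1 / (2 * t) * ((norm (xs - xhat m))\<^sup>2 - (norm (xs - x (Suc m)))\<^sup>2)" for m
      using step[of m xs] by (simp add: v_def T_xs penalty_xs)
  qed
  moreover have "J (x k) - J xs \<le> v k"
  proof -
    have "x k = T (y (k - 1))"
      using x_T[of "k - 1"] k_pos by simp
    then have "V (x k) / t \<le> prox_penalty (y (k - 1)) / t"
      using V_clique_proj_le[of "y (k - 1)"] t by (intro divide_right_mono) auto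
    then show ?thesis
      by (simp add: J_eq v_def V_xs)
  qed
  ultimately show ?thesis
    by (simp add: x_0)
qed

end
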